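(* Let $\widehat{\alpha}$ and $\widehat{\beta}$ be two dual space curves in $\mathbb{D}^3$. If $\widehat{\alpha}$ and $\widehat{\beta}$ are Bertrand curves, $\widehat\kappa(s)$ and $\widehat\tau(s)$ are the curvature and torsion of $\widehat\alpha$, and $\widehat{\kappa^\circ}(s)$ and $\widehat{\tau^\circ}(s)$ are the curvature and torsion of $\widehat\beta$, then there are constants $\widehat\lambda,\widehat\mu\in\mathbb{D}$ such that $$\widehat\lambda\,\widehat\kappa(s)+\widehat\mu\,\widehat\tau(s)=1$$ for all $s$.
   Context: Dual numbers: $\mathbb{D}=\{\widehat a=a+\varepsilon a^*: a,a^*\in\mathbb{R}\}$ with $\varepsilon^2=0$, a commutative ring under $(a+\varepsilon a^* )+(b+\varepsilon b^* )=(a+b)+\varepsilon(a^*+b^* )$ and $(a+\varepsilon a^* )(b+\varepsilon b^* )=ab+\varepsilon(ab^*+ba^* )$. A dual number is pure-dual if its real part $a$ is $0$. $\mathbb{D}^3$ is the $\mathbb{D}$-module of dual vectors $\widehat a=a+\varepsilon a^*$ with $a,a^*\in\mathbb{R}^3$. Inner product: $\langle\widehat a,\widehat b\rangle=\langle a,b\rangle+\varepsilon(\langle a,b^*\rangle+\langle a^*,b\rangle)$. The cross product is given by the usual coordinate formula with dual entries. Norm: $\|\widehat a\|=\sqrt{\langle\widehat a,\widehat a\rangle}=\|a\|+\varepsilon\frac{\langle a,a^*\rangle}{\|a\|}$ for $a\neq0$. A dual space curve is a map $\widehat\alpha:I\subset\mathbb{D}\to\mathbb{D}^3$, $\widehat\alpha(s)=\alpha(s)+\varepsilon\alpha^*(s)$,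 with $\alpha,\alpha^*$ differentiable vector functions. With respect to its dual arc-length parameter, its Frenet frame $\{\widehat T,\widehat N,\widehat B\}$ (unit tangent, unit principal normal, $\widehat B=\widehat T\times\widehat N$), curvature $\widehat\kappa$ and torsion $\widehat\tau$ (both $\mathbb{D}$-valued and nowhere pure-dual) satisfy $\widehat T=\widehat\alpha'$, $\widehat T'=\widehat\kappa\widehat N$, $\widehat N'=-\widehat\kappa\widehat T+\widehat\tau\widehat B$, $\widehat B'=-\widehat\tau\widehat N$. Curves are assumed regular enough for these to exist. Bertrand curves: $\widehat\alpha$ and $\widehat\beta$ are called Bertrand curves if there is a correspondence between their points such that the principal normal vectors of $\widehat\alpha$ and $\widehat\beta$ at corresponding points are linearly dependent (each is a multiple of the other by a dual number), with corresponding points joined along the principal normal: $\widehat\beta(s)=\widehat\alpha(s)+\widehat\lambda(s)\widehat N(s)$ for some differentiable dual-valued function $\widehat\lambda$. Here $s$ is the arc-length parameter of $\widehat\alpha$, $\widehat N$ is the principal normal of $\widehat\alpha$, and $\widehat\beta(s)$ denotes the point of $\widehat\beta$ corresponding to $\widehat\alpha(s)$.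
   Formalization: Added hypothesis: the joining function λ(s) is not pure-dual for at least one s. Without it the claim fails: λ=0 makes every curve its own mate, and λ=εc with τ of constant real part gives distinct mates with no such linear relation. *)

theory Defs
  imports "HOL-Analysis.Analysis"
begin

datatype dual = Dual (rp: real) (dp: real)

lemma dual_eq_iff: "x = y \<longleftrightarrow> rp x = rp y \<and> dp x = dp y"
  by (cases x; cases y) simp

instantiation dual :: comm_ring_1
begin

definition "0 = Dual 0 0"
definition "1 = Dual 1 0"
definition "x + y = Dual (rp x + rp y) (dp x + dp y)"
definition "- x = Dual (- rp x) (- dp x)"
definition "x - y = Dual (rp x - rp y) (dp x - dp y)"
definition "x * y = Dual (rp x * rp y) (rp x * dp y + dp x * rp y)"

instance
  by standard
    (simp_all add: dual_eq_iff zero_dual_def one_dual_def plus_dual_def uminus_dual_def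
      minus_dual_def times_dual_def algebra_simps)

end

lemma dual_sel [simp]:
  "rp 0 = 0" "dp 0 = 0" "rp 1 = 1" "dp 1 = 0"
  "rp (x + y) = rp x + rp y" "dp (x + y) = dp x + dp y"
  "rp (- x) = - rp x" "dp (- x) = - dp x"
  "rp (x - y) = rp x - rp y" "dp (x - y) = dp x - dp y"
  "rp (x * y) = rp x * rp y" "dp (x * y) = rp x * dp y + dp x * rp y"
  by (simp_all add: zero_dual_def one_dual_def plus_dual_def uminus_dual_def
      minus_dual_def times_dual_def)

instantiation dual :: real_vector
begin

definition "r *\<^sub>R x = Dual (r * rp x) (r * dp x)"

instance
  by standard (simp_all add: dual_eq_iff scaleR_dual_def algebra_simps)

end

text \<open>
  The type-class \<open>norm\<close> on dual numbers is the (real-valued, submultiplicative) l1 norm of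
  \<open>(rp x, dp x)\<close>. Its only role is to provide the Euclidean topology of the plane, and hence
  Frechet derivatives. The geometric, dual-valued norm of a dual vector is \<open>dnorm\<close> below.
\<close>

instantiation dual :: real_normed_algebra_1
begin

definition "norm x = \<bar>rp x\<bar> + \<bar>dp x\<bar>"
definition "dist (x::dual) y = norm (x - y)"
definition "sgn (x::dual) = x /\<^sub>R norm x"
definition [code del]:
  "(uniformity :: (dual \<times> dual) filter) = (INF e\<in>{0 <..}. principal {(x, y). dist x y < e})"
definition [code del]:
  "open (U :: dual set) \<longleftrightarrow> (\<forall>x\<in>U. eventually (\<lambda>(x', y). x' = x \<longrightarrow> y \<in> U) uniformity)"

instance
proof
  fix r :: real and x y :: dual and U :: "dual set"
  show "r *\<^sub>R x * y = r *\<^sub>R (x * y)" "x * r *\<^sub>R y = r *\<^sub>R (x * y)"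
    by (simp_all add: dual_eq_iff scaleR_dual_def algebra_simps)
  show "dist x y = norm (x - y)" by (rule dist_dual_def)
  show "sgn x = x /\<^sub>R norm x" by (rule sgn_dual_def)
  show "(uniformity :: (dual \<times> dual) filter) = (INF e\<in>{0 <..}. principal {(x, y). dist x y < e})"
    by (rule uniformity_dual_def)
  show "open U \<longleftrightarrow> (\<forall>x\<in>U. eventually (\<lambda>(x', y). x' = x \<longrightarrow> y \<in> U) uniformity)"
    by (rule open_dual_def)
  show "norm x = 0 \<longleftrightarrow> x = 0" by (auto simp: norm_dual_def dual_eq_iff)
  show "norm (x + y) \<le> norm x + norm y" by (simp add: norm_dual_def)
  show "norm (r *\<^sub>R x) = \<bar>r\<bar> * norm x"
    by (simp add: norm_dual_def scaleR_dual_def abs_mult algebra_simps)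
  show "norm (1::dual) = 1" by (simp add: norm_dual_def)
  have "\<bar>rp x * dp y + dp x * rp y\<bar> \<le> \<bar>rp x\<bar> * \<bar>dp y\<bar> + \<bar>dp x\<bar> * \<bar>rp y\<bar>"
    by (metis abs_mult abs_triangle_ineq)
  moreover have "0 \<le> \<bar>dp x\<bar> * \<bar>dp y\<bar>" by simp
  ultimately show "norm (x * y) \<le> norm x * norm y"
    unfolding norm_dual_def dual_sel abs_mult distrib_left distrib_right by linarith
qed

end

definition pure_dual :: "dual \<Rightarrow> bool" where
  "pure_dual x \<longleftrightarrow> rp x = 0"

text \<open>The module of dual vectors is \<open>dual ^ 3\<close>, with scalar multiplication \<open>c *s v\<close>.\<close>

definition vrp :: "dual ^ 3 \<Rightarrow> real ^ 3" where
  "vrp a = (\<chi> i. rp (a $ i))"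

definition vdp :: "dual ^ 3 \<Rightarrow> real ^ 3" where
  "vdp a = (\<chi> i. dp (a $ i))"

definition dinner :: "dual ^ 3 \<Rightarrow> dual ^ 3 \<Rightarrow> dual" where
  "dinner a b = Dual (vrp a \<bullet> vrp b) (vrp a \<bullet> vdp b + vdp a \<bullet> vrp b)"

definition dcross :: "dual ^ 3 \<Rightarrow> dual ^ 3 \<Rightarrow> dual ^ 3" where
  "dcross a b = vector [a $ 2 * b $ 3 - a $ 3 * b $ 2,
                        a $ 3 * b $ 1 - a $ 1 * b $ 3,
                        a $ 1 * b $ 2 - a $ 2 * b $ 1]"

text \<open>Meaningful for \<open>vrp a \<noteq> 0\<close>; otherwise the value is \<open>0\<close>, so \<open>dnorm a = 1\<close> forces
  \<open>vrp a \<noteq> 0\<close>.\<close>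
definition dnorm :: "dual ^ 3 \<Rightarrow> dual" where
  "dnorm a = Dual (norm (vrp a)) (vrp a \<bullet> vdp a / norm (vrp a))"

text \<open>
  Derivatives with respect to a dual variable: the Frechet derivative is multiplication by the
  dual number (or dual vector) \<open>d\<close>, in analogy with \<open>has_field_derivative\<close>, which is not available
  because the dual numbers are not a field.
\<close>
definition has_dual_deriv :: "(dual \<Rightarrow> dual) \<Rightarrow> dual \<Rightarrow> dual \<Rightarrow> bool" where
  "has_dual_deriv f d x \<longleftrightarrow> (f has_derivative (\<lambda>h. h * d)) (at x)"

definition has_dual_vderiv :: "(dual \<Rightarrow> dual ^ 3) \<Rightarrow> dual ^ 3 \<Rightarrow> dual \<Rightarrow> bool" where
  "has_dual_vderiv f d x \<longleftrightarrow> (f has_derivative (\<lambda>h. h *s d)) (at x)"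

definition dual_differentiable_on :: "(dual \<Rightarrow> dual) \<Rightarrow> dual set \<Rightarrow> bool" where
  "dual_differentiable_on f I \<longleftrightarrow> (\<forall>x\<in>I. \<exists>d. has_dual_deriv f d x)"

text \<open>
  Parameter domains are regions of the plane of dual numbers rather than convex sets, because
  the arc-length domains of two corresponding curves are images of each other under a
  differentiable map, which need not preserve convexity. The open strips
  \<open>{x. a < rp x \<and> rp x < b}\<close> are the typical example.
\<close>
definition dual_domain :: "dual set \<Rightarrow> bool" where
  "dual_domain I \<longleftrightarrow> I \<noteq> {} \<and> open I \<and> connected I"

text \<open>
  \<open>\<alpha>\<close> is a curve on \<open>I\<close> parametrized by dual arc length, with Frenet frame \<open>T, N, B\<close>, curvature
  \<open>\<kappa>\<close> and torsion \<open>\<tau>\<close>. Orthogonality of \<open>T\<close> and \<open>N\<close> need not be listed: differentiating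
  \<open>dinner T T = 1\<close> gives \<open>2 * \<kappa> * dinner T N = 0\<close>, and \<open>\<kappa>\<close> is a unit.
\<close>
definition dual_frenet_curve ::
    "dual set \<Rightarrow> (dual \<Rightarrow> dual ^ 3) \<Rightarrow> (dual \<Rightarrow> dual ^ 3) \<Rightarrow> (dual \<Rightarrow> dual ^ 3)
      \<Rightarrow> (dual \<Rightarrow> dual ^ 3) \<Rightarrow> (dual \<Rightarrow> dual) \<Rightarrow> (dual \<Rightarrow> dual) \<Rightarrow> bool" where
  "dual_frenet_curve I \<alpha> T N B \<kappa> \<tau> \<longleftrightarrow>
     dual_domain I \<and>
     (\<forall>s\<in>I.
        dnorm (T s) = 1 \<and> dnorm (N s) = 1 \<and> B s = dcross (T s) (N s) \<and>
        \<not> pure_dual (\<kappa> s) \<and> \<not> pure_dual (\<tau> s) \<and>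
        has_dual_vderiv \<alpha> (T s) s \<and>
        has_dual_vderiv T (\<kappa> s *s N s) s \<and>
        has_dual_vderiv N (- (\<kappa> s *s T s) + \<tau> s *s B s) s \<and>
        has_dual_vderiv B (- (\<tau> s *s N s)) s)"

text \<open>
  \<open>\<alpha>\<close> on \<open>I\<close> and \<open>\<beta>\<close> on \<open>J\<close>, with principal normals \<open>N\<close> and \<open>N'\<close>, are Bertrand curves via the
  correspondence \<open>\<alpha> s \<mapsto> \<beta> (\<phi> s)\<close> and the offset function \<open>lam\<close>. Each curve keeps its own
  arc-length parameter, so \<open>\<phi> s\<close> is the arc-length parameter on \<open>\<beta>\<close> of the point corresponding
  to \<open>\<alpha> s\<close>.
\<close>
definition bertrand_curves ::
    "dual set \<Rightarrow> (dual \<Rightarrow> dual ^ 3) \<Rightarrow> (dual \<Rightarrow> dual ^ 3)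
      \<Rightarrow> dual set \<Rightarrow> (dual \<Rightarrow> dual ^ 3) \<Rightarrow> (dual \<Rightarrow> dual ^ 3)
      \<Rightarrow> (dual \<Rightarrow> dual) \<Rightarrow> (dual \<Rightarrow> dual) \<Rightarrow> bool" where
  "bertrand_curves I \<alpha> N J \<beta> N' \<phi> lam \<longleftrightarrow>
     \<phi> ` I = J \<and> dual_differentiable_on \<phi> I \<and> dual_differentiable_on lam I \<and>
     (\<forall>s\<in>I. (\<exists>c. N' (\<phi> s) = c *s N s) \<and> (\<exists>c. N s = c *s N' (\<phi> s)) \<and>
             \<beta> (\<phi> s) = \<alpha> s + lam s *s N s)"

end

theory Submission
  imports Defs
begin

text \<open>
  The argument is the classical one for Bertrand curves: two unit tangents at corresponding points
  make a constant angle, and its cotangent is the ratio of the two constants in the linear relation.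

  Write \<open>\<beta> (\<phi> s) = \<alpha> s + lam s *s N s\<close> and differentiate. The chain rule and the Frenet equations
  give \<open>p *s T' (\<phi> s) = (1 - lam s * \<kappa> s) *s T s + l' *s N s + (lam s * \<tau> s) *s B s\<close>, where \<open>p\<close> and
  \<open>l'\<close> are the derivatives of \<open>\<phi>\<close> and \<open>lam\<close> (\<open>bertrand_tangent_projection\<close>). Since the principal
  normals of the two curves are multiples of each other, \<open>T' (\<phi> s)\<close> is orthogonal to \<open>N s\<close>; the
  \<open>N\<close>-component therefore says \<open>l' = 0\<close>, and \<open>lam\<close> is a constant \<open>l\<close> on the connected domain.

  The components \<open>P = dinner (T' (\<phi> s)) (T s)\<close> and \<open>Q = dinner (T' (\<phi> s)) (B s)\<close> (dual cosine and
  sine of the angle between the tangents) are constant too: their derivatives only involve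
  products of one curve's normal with the other curve's tangent or with \<open>B s\<close>, and these vanish.
  Comparing components leaves \<open>p * P = 1 - l * \<kappa> s\<close> and \<open>p * Q = l * \<tau> s\<close>. Since \<open>l\<close>
  and \<open>\<tau> s\<close> are not pure-dual, neither is the factor \<open>Q\<close> of their product, so \<open>Q\<close> is invertible.
  Eliminating \<open>p\<close> gives \<open>l * \<kappa> s + (P / Q) * l * \<tau> s = 1\<close>.
\<close>

section \<open>Dual numbers and dual vectors\<close>

lemma not_pure_dual_invertible:
  assumes "\<not> pure_dual x"
  obtains y where "x * y = 1"
proof
  \<comment> \<open>The inverse of \<open>a + \<epsilon> b\<close> is \<open>1 / a - \<epsilon> b / a\<^sup>2\<close>.\<close>
  show "x * Dual (1 / rp x) (- dp x / (rp x)\<^sup>2) = 1"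
    using assms by (simp add: dual_eq_iff pure_dual_def power2_eq_square field_simps)
qed

lemma not_pure_dual_mult:
  "\<not> pure_dual (x * y) \<longleftrightarrow> \<not> pure_dual x \<and> \<not> pure_dual y"
  by (simp add: pure_dual_def)

lemma dinner_eq_sum: "dinner a b = a $ 1 * b $ 1 + a $ 2 * b $ 2 + a $ 3 * b $ 3"
  by (simp add: dual_eq_iff dinner_def vrp_def vdp_def inner_vec_def sum_3)

lemma dinner_commute: "dinner a b = dinner b a"
  by (simp add: dinner_eq_sum mult.commute)

lemma dinner_simps:
  "dinner (a + b) c = dinner a c + dinner b c"
  "dinner (a - b) c = dinner a c - dinner b c"
  "dinner (- a) c = - dinner a c"
  "dinner (k *s a) c = k * dinner a c"
  "dinner a (b + c) = dinner a b + dinner a c"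
  "dinner a (- c) = - dinner a c"
  "dinner a (k *s c) = k * dinner a c"
  "dinner a 0 = 0"
  by (simp_all add: dinner_eq_sum algebra_simps)

lemma dinner_self_of_dnorm:
  assumes "dnorm a = 1"
  shows "dinner a a = 1"
proof -
  have "norm (vrp a) = 1" "vrp a \<bullet> vdp a = 0"
    using assms by (auto simp: dnorm_def dual_eq_iff)
  then show ?thesis
    by (simp add: dinner_def dual_eq_iff inner_commute power2_norm_eq_inner[symmetric])
qed

lemma dinner_dcross_left: "dinner a (dcross a b) = 0"
  by (simp add: dinner_eq_sum dcross_def algebra_simps)

lemma dinner_dcross_right: "dinner b (dcross a b) = 0"
  by (simp add: dinner_eq_sum dcross_def algebra_simps)

lemma dinner_dcross_dcross:
  "dinner (dcross a b) (dcross a b) = dinner a a * dinner b b - dinner a b * dinner a b"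
  by (simp add: dinner_eq_sum dcross_def algebra_simps)

section \<open>Derivatives along a dual parameter\<close>

lemma has_dual_deriv_unique:
  assumes "has_dual_deriv f d x" "has_dual_deriv f e x"
  shows "d = e"
proof -
  have "(\<lambda>h. h * d) = (\<lambda>h. h * e)"
    using assms unfolding has_dual_deriv_def by (rule has_derivative_unique)
  then show ?thesis by (metis mult_1)
qed

lemma has_dual_deriv_const: "has_dual_deriv (\<lambda>_. c) 0 x"
  by (simp add: has_dual_deriv_def)

lemma has_dual_vderiv_const: "has_dual_vderiv (\<lambda>_. c) 0 x"
  by (simp add: has_dual_vderiv_def)

lemma has_dual_deriv_add:
  assumes "has_dual_deriv f d x" "has_dual_deriv g e x"
  shows "has_dual_deriv (\<lambda>x. f x + g x) (d + e) x"
  using has_derivative_add[OF assms[unfolded has_dual_deriv_def]]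
  by (simp add: has_dual_deriv_def distrib_left)

lemma has_dual_deriv_mult:
  assumes "has_dual_deriv f d x" "has_dual_deriv g e x"
  shows "has_dual_deriv (\<lambda>x. f x * g x) (d * g x + f x * e) x"
  using has_derivative_mult[OF assms[unfolded has_dual_deriv_def]]
  by (simp add: has_dual_deriv_def algebra_simps)

lemma has_dual_deriv_component:
  assumes "has_dual_vderiv f d x"
  shows "has_dual_deriv (\<lambda>x. f x $ i) (d $ i) x"
  using bounded_linear.has_derivative[OF bounded_linear_vec_nth assms[unfolded has_dual_vderiv_def]]
  by (simp add: has_dual_deriv_def)

lemma has_dual_deriv_dinner:
  assumes "has_dual_vderiv f d x" "has_dual_vderiv g e x"
  shows "has_dual_deriv (\<lambda>x. dinner (f x) (g x)) (dinner d (g x) + dinner (f x) e) x"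
proof -
  have "has_dual_deriv (\<lambda>x. f x $ i * g x $ i) (d $ i * g x $ i + f x $ i * e $ i) x" for i
    by (intro has_dual_deriv_mult has_dual_deriv_component assms)
  from has_dual_deriv_add[OF has_dual_deriv_add[OF this[of 1] this[of 2]] this[of 3]]
  show ?thesis by (simp add: dinner_eq_sum algebra_simps)
qed

lemma has_dual_vderiv_chain:
  assumes "has_dual_deriv f d x" "has_dual_vderiv g e (f x)"
  shows "has_dual_vderiv (\<lambda>x. g (f x)) (d *s e) x"
  using has_derivative_compose[OF assms[unfolded has_dual_deriv_def has_dual_vderiv_def]]
  by (simp add: has_dual_vderiv_def)

lemma has_dual_deriv_zero_constant:
  assumes "dual_domain I" "\<And>s. s \<in> I \<Longrightarrow> has_dual_deriv f 0 s"
  obtains c where "\<And>s. s \<in> I \<Longrightarrow> f s = c"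
proof -
  obtain s\<^sub>0 where s\<^sub>0: "s\<^sub>0 \<in> I" and I: "open I" "connected I"
    using assms(1) by (auto simp: dual_domain_def)
  have "(f has_derivative (\<lambda>h. 0)) (at s)" if "s \<in> I" for s
    using assms(2)[OF that] by (simp add: has_dual_deriv_def)
  then show thesis
    using has_derivative_zero_unique_connected[OF I _ _ s\<^sub>0, of f] that by blast
qed

lemma has_dual_deriv_transform:
  assumes "has_dual_deriv f d x" "open I" "x \<in> I" "\<And>y. y \<in> I \<Longrightarrow> f y = g y"
  shows "has_dual_deriv g d x"
  using has_derivative_transform_within_open[OF assms(1)[unfolded has_dual_deriv_def] assms(2-4)]
  by (simp add: has_dual_deriv_def)

section \<open>Orthonormality of the dual Frenet frame\<close>

text \<open>
  Differentiating \<open>dinner (T s) (T s) = 1\<close> gives orthogonality of \<open>T\<close> and \<open>N\<close>, because \<open>\<kappa> s\<close> is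
  invertible; the relations for \<open>B\<close> are then the identities for the cross product.
\<close>
lemma frenet_frame_orthonormal:
  assumes "dual_frenet_curve I \<alpha> T N B \<kappa> \<tau>" "s \<in> I"
  shows "dinner (T s) (T s) = 1" "dinner (N s) (N s) = 1" "dinner (B s) (B s) = 1"
    and "dinner (T s) (N s) = 0" "dinner (T s) (B s) = 0" "dinner (N s) (B s) = 0"
proof -
  note curve = assms(1)[unfolded dual_frenet_curve_def dual_domain_def]
  have unit: "dinner (T t) (T t) = 1" if "t \<in> I" for t
    using curve that by (auto intro: dinner_self_of_dnorm)
  show TT: "dinner (T s) (T s) = 1" using unit assms(2) .
  show NN: "dinner (N s) (N s) = 1" using curve assms(2) by (auto intro: dinner_self_of_dnorm)
  have dT: "has_dual_vderiv T (\<kappa> s *s N s) s" using curve assms(2) by auto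
  have "has_dual_deriv (\<lambda>_. 1)
          (dinner (\<kappa> s *s N s) (T s) + dinner (T s) (\<kappa> s *s N s)) s"
    using has_dual_deriv_transform[OF has_dual_deriv_dinner[OF dT dT], of I "\<lambda>_. 1"]
      curve assms(2) unit by auto
  from has_dual_deriv_unique[OF this has_dual_deriv_const]
  have "\<kappa> s * dinner (T s) (N s) + \<kappa> s * dinner (T s) (N s) = 0"
    by (simp add: dinner_simps dinner_commute[of "N s" "T s"])
  then have \<kappa>TN: "\<kappa> s * dinner (T s) (N s) = 0"
    by (simp flip: scaleR_2)
  have "\<not> pure_dual (\<kappa> s)" using curve assms(2) by auto
  then obtain k where "\<kappa> s * k = 1" by (rule not_pure_dual_invertible)
  then have "dinner (T s) (N s) = k * (\<kappa> s * dinner (T s) (N s))"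
    by (simp add: mult.assoc[symmetric] mult.commute[of k])
  then show TN: "dinner (T s) (N s) = 0" by (simp add: \<kappa>TN)
  have B: "B s = dcross (T s) (N s)" using curve assms(2) by auto
  show "dinner (T s) (B s) = 0" "dinner (N s) (B s) = 0" "dinner (B s) (B s) = 1"
    using TT NN TN by (simp_all add: B dinner_dcross_left dinner_dcross_right dinner_dcross_dcross)
qed

section \<open>Bertrand curves\<close>

text \<open>
  Differentiating the offset equation. Pairing with an arbitrary constant vector \<open>c\<close> makes it an
  equation between dual-valued functions, so that the product rule for dual numbers suffices.
\<close>
lemma bertrand_tangent_projection:
  assumes \<alpha>: "dual_frenet_curve I \<alpha> T N B \<kappa> \<tau>"
    and \<beta>: "dual_frenet_curve J \<beta> T' N' B' \<kappa>' \<tau>'"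
    and bertrand: "bertrand_curves I \<alpha> N J \<beta> N' \<phi> lam"
    and s: "s \<in> I" and p: "has_dual_deriv \<phi> p s" and l': "has_dual_deriv lam l' s"
  shows "p * dinner (T' (\<phi> s)) c =
           (1 - lam s * \<kappa> s) * dinner (T s) c + l' * dinner (N s) c + lam s * \<tau> s * dinner (B s) c"
proof -
  have "\<phi> s \<in> J" using bertrand s by (auto simp: bertrand_curves_def)
  then have "has_dual_vderiv (\<lambda>s. \<beta> (\<phi> s)) (p *s T' (\<phi> s)) s"
    using \<beta> by (auto simp: dual_frenet_curve_def intro: has_dual_vderiv_chain[OF p])
  from has_dual_deriv_dinner[OF this has_dual_vderiv_const[of c]]
  have lhs: "has_dual_deriv (\<lambda>s. dinner (\<beta> (\<phi> s)) c) (p * dinner (T' (\<phi> s)) c) s"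
    by (simp add: dinner_simps)
  have d\<alpha>: "has_dual_vderiv \<alpha> (T s) s"
    and dN: "has_dual_vderiv N (- (\<kappa> s *s T s) + \<tau> s *s B s) s"
    and "open I"
    using \<alpha> s by (auto simp: dual_frenet_curve_def dual_domain_def)
  have dN': "has_dual_deriv (\<lambda>s. dinner (N s) c) (- (\<kappa> s * dinner (T s) c) + \<tau> s * dinner (B s) c) s"
    using has_dual_deriv_dinner[OF dN has_dual_vderiv_const[of c]] by (simp add: dinner_simps)
  have "has_dual_deriv (\<lambda>s. dinner (\<alpha> s) c) (dinner (T s) c) s"
    using has_dual_deriv_dinner[OF d\<alpha> has_dual_vderiv_const[of c]] by (simp add: dinner_simps)
  from has_dual_deriv_add[OF this has_dual_deriv_mult[OF l' dN']]
  have "has_dual_deriv (\<lambda>s. dinner (\<beta> (\<phi> s)) c)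
      (dinner (T s) c + (l' * dinner (N s) c +
         lam s * (- (\<kappa> s * dinner (T s) c) + \<tau> s * dinner (B s) c))) s"
    by (rule has_dual_deriv_transform[OF _ \<open>open I\<close> s])
       (use bertrand in \<open>auto simp: bertrand_curves_def dinner_simps\<close>)
  from has_dual_deriv_unique[OF lhs this] show ?thesis
    by (simp add: algebra_simps)
qed

text \<open>
  Each principal normal is a multiple of the other, so it inherits the other one's
  orthogonality relations.
\<close>
lemma bertrand_orthogonal:
  assumes \<alpha>: "dual_frenet_curve I \<alpha> T N B \<kappa> \<tau>"
    and \<beta>: "dual_frenet_curve J \<beta> T' N' B' \<kappa>' \<tau>'"
    and bertrand: "bertrand_curves I \<alpha> N J \<beta> N' \<phi> lam"
    and s: "s \<in> I"
  shows "dinner (T' (\<phi> s)) (N s) = 0" "dinner (N' (\<phi> s)) (T s) = 0" "dinner (N' (\<phi> s)) (B s) = 0"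
proof -
  obtain c d where c: "N' (\<phi> s) = c *s N s" and d: "N s = d *s N' (\<phi> s)" and "\<phi> s \<in> J"
    using bertrand s unfolding bertrand_curves_def by blast
  show "dinner (T' (\<phi> s)) (N s) = 0"
    using frenet_frame_orthonormal(4)[OF \<beta> \<open>\<phi> s \<in> J\<close>] by (subst d) (simp add: dinner_simps)
  show "dinner (N' (\<phi> s)) (T s) = 0" "dinner (N' (\<phi> s)) (B s) = 0"
    using frenet_frame_orthonormal[OF \<alpha> s]
    by (simp_all add: c dinner_simps dinner_commute[of "N s" "T s"])
qed

lemma bertrand_offset_constant:
  assumes \<alpha>: "dual_frenet_curve I \<alpha> T N B \<kappa> \<tau>"
    and \<beta>: "dual_frenet_curve J \<beta> T' N' B' \<kappa>' \<tau>'"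
    and bertrand: "bertrand_curves I \<alpha> N J \<beta> N' \<phi> lam"
  obtains l where "\<And>s. s \<in> I \<Longrightarrow> lam s = l"
proof -
  have I: "dual_domain I" using \<alpha> by (simp add: dual_frenet_curve_def)
  have "has_dual_deriv lam 0 s" if s: "s \<in> I" for s
  proof -
    obtain p l' where p: "has_dual_deriv \<phi> p s" and l': "has_dual_deriv lam l' s"
      using bertrand s unfolding bertrand_curves_def dual_differentiable_on_def by blast
    have "l' = 0"
      using bertrand_tangent_projection[OF \<alpha> \<beta> bertrand s p l', of "N s"]
        bertrand_orthogonal(1)[OF \<alpha> \<beta> bertrand s] frenet_frame_orthonormal[OF \<alpha> s]
      by (simp add: dinner_commute[of "B s" "N s"])
    with l' show ?thesis by simp
  qed
  then show thesis
    using has_dual_deriv_zero_constant[OF I, of lam] that by blast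
qed

text \<open>
  The tangents of the two curves make a constant dual angle: in the derivative of \<open>P\<close> and of
  \<open>Q\<close>, both summands contain one curve's principal normal paired with a vector orthogonal to it.
\<close>
lemma bertrand_angle_constant:
  assumes \<alpha>: "dual_frenet_curve I \<alpha> T N B \<kappa> \<tau>"
    and \<beta>: "dual_frenet_curve J \<beta> T' N' B' \<kappa>' \<tau>'"
    and bertrand: "bertrand_curves I \<alpha> N J \<beta> N' \<phi> lam"
  obtains P Q where "\<And>s. s \<in> I \<Longrightarrow> dinner (T' (\<phi> s)) (T s) = P"
    and "\<And>s. s \<in> I \<Longrightarrow> dinner (T' (\<phi> s)) (B s) = Q"
proof -
  have I: "dual_domain I" using \<alpha> by (simp add: dual_frenet_curve_def)
  have deriv: "has_dual_deriv (\<lambda>s. dinner (T' (\<phi> s)) (T s)) 0 s"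
      "has_dual_deriv (\<lambda>s. dinner (T' (\<phi> s)) (B s)) 0 s" if s: "s \<in> I" for s
  proof -
    obtain p where p: "has_dual_deriv \<phi> p s"
      using bertrand s unfolding bertrand_curves_def dual_differentiable_on_def by blast
    have "\<phi> s \<in> J" using bertrand s by (auto simp: bertrand_curves_def)
    then have "has_dual_vderiv T' (\<kappa>' (\<phi> s) *s N' (\<phi> s)) (\<phi> s)"
      using \<beta> by (auto simp: dual_frenet_curve_def)
    note product_rule = has_dual_deriv_dinner[OF has_dual_vderiv_chain[OF p this]]
    have "has_dual_vderiv T (\<kappa> s *s N s) s" "has_dual_vderiv B (- (\<tau> s *s N s)) s"
      using \<alpha> s by (auto simp: dual_frenet_curve_def)
    from this[THEN product_rule]
    show "has_dual_deriv (\<lambda>s. dinner (T' (\<phi> s)) (T s)) 0 s"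
      and "has_dual_deriv (\<lambda>s. dinner (T' (\<phi> s)) (B s)) 0 s"
      using bertrand_orthogonal[OF \<alpha> \<beta> bertrand s] by (simp_all add: dinner_simps)
  qed
  from has_dual_deriv_zero_constant[OF I deriv(1)] obtain P
    where "\<And>s. s \<in> I \<Longrightarrow> dinner (T' (\<phi> s)) (T s) = P" by blast
  moreover from has_dual_deriv_zero_constant[OF I deriv(2)] obtain Q
    where "\<And>s. s \<in> I \<Longrightarrow> dinner (T' (\<phi> s)) (B s) = Q" by blast
  ultimately show thesis by (rule that)
qed

theorem theorem3:
  fixes I J :: "dual set"
    and \<alpha> T N B \<beta> T' N' B' :: "dual \<Rightarrow> dual ^ 3"
    and \<kappa> \<tau> \<kappa>' \<tau>' \<phi> lam :: "dual \<Rightarrow> dual"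
  assumes "dual_frenet_curve I \<alpha> T N B \<kappa> \<tau>"
    and "dual_frenet_curve J \<beta> T' N' B' \<kappa>' \<tau>'"
    and "bertrand_curves I \<alpha> N J \<beta> N' \<phi> lam"
    and nondegenerate: "\<exists>s\<in>I. \<not> pure_dual (lam s)"
  shows "\<exists>l m :: dual. \<forall>s\<in>I. l * \<kappa> s + m * \<tau> s = 1"
proof -
  obtain l where l: "\<And>s. s \<in> I \<Longrightarrow> lam s = l"
    using bertrand_offset_constant[OF assms(1-3)] by blast
  obtain P Q where P: "\<And>s. s \<in> I \<Longrightarrow> dinner (T' (\<phi> s)) (T s) = P"
    and Q: "\<And>s. s \<in> I \<Longrightarrow> dinner (T' (\<phi> s)) (B s) = Q"
    using bertrand_angle_constant[OF assms(1-3)] by blast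
  have components: "\<exists>p. p * P = 1 - l * \<kappa> s \<and> p * Q = l * \<tau> s" if s: "s \<in> I" for s
  proof -
    obtain p l' where p: "has_dual_deriv \<phi> p s" and l': "has_dual_deriv lam l' s"
      using assms(3) s unfolding bertrand_curves_def dual_differentiable_on_def by blast
    note frame = frenet_frame_orthonormal[OF assms(1) s]
    have "p * P = 1 - l * \<kappa> s"
      using bertrand_tangent_projection[OF assms(1-3) s p l', of "T s"] frame
      by (simp add: P[OF s] l[OF s] dinner_commute[of "N s" "T s"] dinner_commute[of "B s" "T s"])
    moreover have "p * Q = l * \<tau> s"
      using bertrand_tangent_projection[OF assms(1-3) s p l', of "B s"] frame
      by (simp add: Q[OF s] l[OF s])
    ultimately show ?thesis by blast
  qed
  have "\<not> pure_dual Q"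
  proof -
    obtain s where s: "s \<in> I" "\<not> pure_dual l" using nondegenerate l by auto
    then have "\<not> pure_dual (l * \<tau> s)"
      using assms(1) by (auto simp: not_pure_dual_mult dual_frenet_curve_def)
    then show ?thesis using components[OF s(1)] not_pure_dual_mult by metis
  qed
  then obtain q where q: "Q * q = 1" by (rule not_pure_dual_invertible)
  have "l * \<kappa> s + P * q * l * \<tau> s = 1" if s: "s \<in> I" for s
  proof -
    obtain p where "p * P = 1 - l * \<kappa> s" and p: "p * Q = l * \<tau> s"
      using components[OF s] by blast
    moreover have "P * q * l * \<tau> s = p * P"
    proof -
      have "P * q * l * \<tau> s = P * q * (p * Q)" by (simp add: p mult.assoc)
      also have "\<dots> = p * P * (Q * q)" by (simp add: mult_ac)
      finally show ?thesis by (simp add: q)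
    qed
    ultimately show ?thesis by simp
  qed
  then show ?thesis by blast
qed

end
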